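(* Let $d\in\mathbb{N}$ and let $\mathbf{E}\colon\mathbb{F}[\boldsymbol{x}_0]\to\mathbb{F}$ be a linear functional with moments $a_{\boldsymbol{k}}=\mathbf{E}\,\boldsymbol{x}_0^{\boldsymbol{k}}$, $\boldsymbol{k}\in\mathbb{N}^{d+1}$. For all $\boldsymbol{n},\boldsymbol{m}\in\mathbb{N}^{d+1}$ with $\boldsymbol{0}<\boldsymbol{m}\le\boldsymbol{n}$ consider the polynomial $$p_{\boldsymbol{n}\boldsymbol{m}}(\boldsymbol{x}_0)= \begin{vmatrix} 1&\boldsymbol{x}_0^{\boldsymbol{k}_1}&\boldsymbol{x}_0^{\boldsymbol{k}_2}&\cdots&\boldsymbol{x}_0^{\boldsymbol{k}_s}\\ a_{\boldsymbol{0}}&a_{\boldsymbol{k}_1}&a_{\boldsymbol{k}_2}&\cdots&a_{\boldsymbol{k}_s}\\ a_{\boldsymbol{h}_1}&a_{\boldsymbol{k}_1+\boldsymbol{h}_1}&a_{\boldsymbol{k}_2+\boldsymbol{h}_1}&\cdots&a_{\boldsymbol{k}_s+\boldsymbol{h}_1}\\ a_{\boldsymbol{h}_2}&a_{\boldsymbol{k}_1+\boldsymbol{h}_2}&a_{\boldsymbol{k}_2+\boldsymbol{h}_2}&\cdots&a_{\boldsymbol{k}_s+\boldsymbol{h}_2}\\ \vdots&\vdots&\vdots&&\vdots\\ a_{\boldsymbol{h}_r}&a_{\boldsymbol{k}_1+\boldsymbol{h}_r}&a_{\boldsymbol{k}_2+\boldsymbol{h}_r}&\cdots&a_{\boldsymbol{k}_s+\boldsymbol{h}_r}\\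 b_{2\,0}&b_{2\,1}&b_{2\,2}&\cdots& b_{2\,s}\\ \vdots&\vdots&\vdots&&\vdots\\ b_{s-r\,0}&b_{s-r\,1}&b_{s-r\,2}&\cdots& b_{s-r\,s} \end{vmatrix},$$ where 1. $s=s(\boldsymbol{n})-1$ and $\{\boldsymbol{k}\mid\boldsymbol{0}\leq\boldsymbol{k}\leq\boldsymbol{n}\}=\{\boldsymbol{0}=\boldsymbol{k}_0,\boldsymbol{k}_1,\ldots,\boldsymbol{k}_s=\boldsymbol{n}\}$; 2. $r=s(\boldsymbol{n}-\boldsymbol{m})-1$ and $\{\boldsymbol{h}\mid\boldsymbol{0}\leq\boldsymbol{h}\leq\boldsymbol{n}-\boldsymbol{m}\}=\{\boldsymbol{0}=\boldsymbol{h}_0,\boldsymbol{h}_1,\ldots,\boldsymbol{h}_r=\boldsymbol{n}-\boldsymbol{m}\}$; 3. $b_{ij}\in\mathbb{F}$ for all $i,j$. Then the set $\{p_{\boldsymbol{n}\boldsymbol{m}}(\boldsymbol{x}_0)\mid\boldsymbol{0}<\boldsymbol{m}\le\boldsymbol{n}\}$ is a generalized orthogonal polynomial system for $\mathbf{E}$, provided that $p_{\boldsymbol{n}\boldsymbol{m}}(\boldsymbol{x}_0)$ is of degree $\boldsymbol{n}$ for all $\boldsymbol{0}<\boldsymbol{m}\leq\boldsymbol{n}$.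
   Context: $\mathbb{F}$ is a field of characteristic zero and $\mathbb{N}$ is the set of nonnegative integers. $\boldsymbol{x}_0=(x_{00},x_{01},\ldots,x_{0d})$ is a tuple of $d+1$ independent indeterminates and $\boldsymbol{x}_0^{\boldsymbol{k}}=\prod_{j=0}^d x_{0j}^{k_j}$ for $\boldsymbol{k}=(k_0,\ldots,k_d)\in\mathbb{N}^{d+1}$. The order on $\mathbb{N}^{d+1}$ is componentwise: $\boldsymbol{k}\le\boldsymbol{n}$ iff $k_i\le n_i$ for all $i$; $\boldsymbol{0}<\boldsymbol{m}$ means $\boldsymbol{m}\neq\boldsymbol{0}$. $s(\boldsymbol{n})$ denotes the cardinality of $\{\boldsymbol{k}\mid\boldsymbol{0}\le\boldsymbol{k}\le\boldsymbol{n}\}$. A polynomial in $\mathbb{F}[\boldsymbol{x}_0]$ is said to be of degree $\boldsymbol{n}$ if it is a linear combination of monomials $\boldsymbol{x}_0^{\boldsymbol{k}}$ with $\boldsymbol{0}\le\boldsymbol{k}\le\boldsymbol{n}$ and the coefficient of $\boldsymbol{x}_0^{\boldsymbol{n}}$ is nonzero. A set $\{p_{\boldsymbol{n}\boldsymbol{m}}(\boldsymbol{x}_0)\mid\boldsymbol{0}<\boldsymbol{m}\le\boldsymbol{n}\}$, with $p_{\boldsymbol{n}\boldsymbol{m}}$ of degree $\boldsymbol{n}$, is a generalized orthogonal polynomial system for $\mathbf{E}$ if $\mathbf{E}\,\boldsymbol{x}_0^{\boldsymbol{k}}\,p_{\boldsymbol{n}\boldsymbol{m}}(\boldsymbol{x}_0)=0$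 for all $\boldsymbol{0}\le\boldsymbol{k}\le\boldsymbol{n}-\boldsymbol{m}$ and all $\boldsymbol{0}<\boldsymbol{m}\le\boldsymbol{n}$. The enumerations and the constants $b_{ij}$ may depend on $(\boldsymbol{n},\boldsymbol{m})$; the determinant has order $s+1$, with $s-r-1$ rows of $b$'s (indexed $2,\ldots,s-r$; none if $r=s-1$). *)

theory Defs
  imports
    "HOL-Library.Poly_Mapping"
    "HOL-Analysis.Finite_Cartesian_Product"
    "Jordan_Normal_Form.Determinant"
begin

text \<open>
  The \<open>d + 1\<close> indeterminates are indexed by an arbitrary finite (hence nonempty) type \<open>'i\<close>
  with \<open>d + 1\<close> elements. Exponent vectors have type \<open>nat ^ 'i\<close>; the library order on this type is
  the componentwise one and subtraction is componentwise (truncated, but only used as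
  \<open>n - m\<close> with \<open>m \<le> n\<close>). A polynomial is the finitely supported map from exponent vectors to
  its coefficients, with the convolution product of \<open>Poly_Mapping\<close>.
\<close>

type_synonym ('i, 'a) mpoly = "(nat ^ 'i) \<Rightarrow>\<^sub>0 'a"

definition monomial :: "nat ^ 'i \<Rightarrow> ('i::finite, 'a::comm_ring_1) mpoly"
  where "monomial k = Poly_Mapping.single k 1"

definition const_poly :: "'a \<Rightarrow> ('i::finite, 'a::comm_ring_1) mpoly"
  where "const_poly c = Poly_Mapping.single 0 c"

definition scale_poly :: "'a \<Rightarrow> ('i, 'a) mpoly \<Rightarrow> ('i::finite, 'a::comm_ring_1) mpoly"
  where "scale_poly c p = const_poly c * p"

lemma vector_space_scale_poly:
  "vector_space (scale_poly :: 'a::field \<Rightarrow> ('i::finite, 'a) mpoly \<Rightarrow> ('i, 'a) mpoly)"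
  by unfold_locales
    (simp_all add: scale_poly_def const_poly_def algebra_simps single_add mult_single
      flip: mult.assoc)

definition linear_functional :: "(('i::finite, 'a::field) mpoly \<Rightarrow> 'a) \<Rightarrow> bool"
  where "linear_functional E \<longleftrightarrow> Vector_Spaces.linear scale_poly (*) E"

definition moment :: "(('i::finite, 'a::field) mpoly \<Rightarrow> 'a) \<Rightarrow> nat ^ 'i \<Rightarrow> 'a"
  where "moment E k = E (monomial k)"

definition of_degree :: "('i::finite, 'a::field) mpoly \<Rightarrow> nat ^ 'i \<Rightarrow> bool"
  where "of_degree p n \<longleftrightarrow>
    Poly_Mapping.keys p \<subseteq> {0..n} \<and> Poly_Mapping.lookup p n \<noteq> 0"

text \<open>
  The system is treated as a family indexed by all pairs \<open>(n, m)\<close> with \<open>0 < m \<le> n\<close>; values of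
  \<open>p\<close> at other pairs are irrelevant.
\<close>

definition generalized_orthogonal_system ::
    "(('i::finite, 'a::field) mpoly \<Rightarrow> 'a) \<Rightarrow>
     (nat ^ 'i \<Rightarrow> nat ^ 'i \<Rightarrow> ('i, 'a) mpoly) \<Rightarrow> bool"
  where "generalized_orthogonal_system E p \<longleftrightarrow>
    (\<forall>n m. 0 < m \<and> m \<le> n \<longrightarrow>
      of_degree (p n m) n \<and>
      (\<forall>k. 0 \<le> k \<and> k \<le> n - m \<longrightarrow> E (monomial k * p n m) = 0))"

definition box_size :: "nat ^ 'i::finite \<Rightarrow> nat"
  where "box_size n = card {0..n}"

definition enumerates_box :: "(nat \<Rightarrow> nat ^ 'i::finite) \<Rightarrow> nat ^ 'i \<Rightarrow> bool"
  where "enumerates_box k n \<longleftrightarrow>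
    bij_betw k {0..box_size n - 1} {0..n} \<and>
    k 0 = 0 \<and> k (box_size n - 1) = n"

text \<open>
  Rows and columns are numbered \<open>0, \<dots>, s\<close>. Row \<open>0\<close> consists of the monomials, row \<open>l + 1\<close>
  (for \<open>l = 0, \<dots>, r\<close>) of the moments shifted by \<open>h l\<close>, and row \<open>r + l\<close> (for
  \<open>l = 2, \<dots>, s - r\<close>) of the free constants \<open>b l j\<close>.
\<close>

definition det_poly ::
    "(('i::finite, 'a::field) mpoly \<Rightarrow> 'a) \<Rightarrow> nat \<Rightarrow> nat \<Rightarrow>
     (nat \<Rightarrow> nat ^ 'i) \<Rightarrow> (nat \<Rightarrow> nat ^ 'i) \<Rightarrow> (nat \<Rightarrow> nat \<Rightarrow> 'a) \<Rightarrow> ('i, 'a) mpoly"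
  where "det_poly E s r k h b =
    Determinant.det (Matrix.mat (s + 1) (s + 1) (\<lambda>(i, j).
      if i = 0 then monomial (k j)
      else if i \<le> r + 1 then const_poly (moment E (k j + h (i - 1)))
      else const_poly (b (i - r) j)))"

end

theory Submission
  imports Defs
begin

text \<open>
  The determinant depends linearly on its row of monomials, and all its other entries are
  constants. Hence multiplying it by a monomial \<open>\<^bold>x\<^sup>\<^bold>q\<close> and applying the functional \<open>E\<close> amounts
  to doing both to the entries of that row alone (\<open>functional_mult_det\<close>), which turns the row of
  monomials into the row of moments shifted by \<open>q\<close>. If \<open>q \<le> n - m\<close>, then \<open>q\<close> is one of the shifts
  \<open>h 0, \<dots>, h r\<close>, so the same row of moments occurs a second time below and the determinant
  vanishes. That this second occurrence lies inside the matrix is where \<open>0 < m\<close> enters: it makes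
  the box below \<open>n - m\<close> strictly smaller than the box below \<open>n\<close> (\<open>box_size_diff_less\<close>), so that
  \<open>r + 1 \<le> s\<close>.
\<close>

lemma comm_ring_hom_const_poly:
  "comm_ring_hom (const_poly :: 'a::field \<Rightarrow> ('i::finite, 'a) mpoly)"
  by unfold_locales (simp_all add: const_poly_def single_add mult_single)

lemma monomial_mult: "monomial k * monomial l = monomial (k + l)"
  by (simp add: monomial_def mult_single)

lemma linear_functional_sum:
  assumes "linear_functional E"
  shows "E (\<Sum>x\<in>X. f x) = (\<Sum>x\<in>X. E (f x))"
  using assms unfolding linear_functional_def
  by (metis module_hom.sum Vector_Spaces.linear_iff_module_hom)

lemma linear_functional_mult_const_poly:
  assumes "linear_functional E"
  shows "E (p * const_poly c) = E p * c"
proof -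
  have "E (scale_poly c p) = c * E p"
    using assms unfolding linear_functional_def
    by (metis module_hom.scale Vector_Spaces.linear_iff_module_hom)
  then show ?thesis
    by (simp add: scale_poly_def mult.commute)
qed

text \<open>
  Expand along row \<open>0\<close>: the cofactors are determinants of constants, hence themselves constants,
  and \<open>E\<close> can be moved past them to the entries of the row.
\<close>

lemma functional_mult_det:
  assumes E: "linear_functional E"
  shows "E (q * Determinant.det (Matrix.mat (Suc s) (Suc s)
            (\<lambda>(i, j). if i = 0 then f j else const_poly (g i j)))) =
    Determinant.det (Matrix.mat (Suc s) (Suc s)
            (\<lambda>(i, j). if i = 0 then E (q * f j) else g i j))"
    (is "E (q * Determinant.det ?P) = Determinant.det ?S")
proof -
  interpret const: comm_ring_hom "const_poly :: 'b \<Rightarrow> ('a, 'b) mpoly"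
    by (rule comm_ring_hom_const_poly)
  have cofactor: "cofactor ?P 0 j = const_poly (cofactor ?S 0 j)" if "j < Suc s" for j
  proof -
    have "mat_delete ?P 0 j = map_mat const_poly (mat_delete ?S 0 j)"
      using that by (intro eq_matI) (auto simp: mat_delete_def)
    then show ?thesis
      by (simp add: cofactor_def const.hom_mult const.hom_power const.hom_uminus)
  qed
  have "Determinant.det ?P = (\<Sum>j<Suc s. ?P $$ (0, j) * cofactor ?P 0 j)"
    by (rule laplace_expansion_row) auto
  also have "\<dots> = (\<Sum>j<Suc s. f j * const_poly (cofactor ?S 0 j))"
    by (intro sum.cong refl) (simp add: cofactor)
  finally have "E (q * Determinant.det ?P) =
      (\<Sum>j<Suc s. E (q * f j * const_poly (cofactor ?S 0 j)))"
    by (simp only: sum_distrib_left linear_functional_sum[OF E] mult.assoc)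
  also have "\<dots> = (\<Sum>j<Suc s. ?S $$ (0, j) * cofactor ?S 0 j)"
    by (intro sum.cong refl) (simp add: linear_functional_mult_const_poly[OF E])
  also have "\<dots> = Determinant.det ?S"
    by (rule laplace_expansion_row[symmetric]) auto
  finally show ?thesis .
qed

text \<open>
  Under \<open>E\<close>, the product with \<open>monomial (h l)\<close> replaces row \<open>0\<close> by a copy of row \<open>l + 1\<close>.
\<close>

lemma functional_monomial_mult_det_poly:
  assumes "linear_functional E" and "l \<le> r" and "r < s"
  shows "E (monomial (h l) * det_poly E s r k h b) = 0"
proof -
  let ?g = "\<lambda>i j. if i \<le> r + 1 then moment E (k j + h (i - 1)) else b (i - r) j"
  let ?A = "Matrix.mat (Suc s) (Suc s)
    (\<lambda>(i, j). if i = 0 then E (monomial (h l) * monomial (k j)) else ?g i j)"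
  have "det_poly E s r k h b = Determinant.det (Matrix.mat (Suc s) (Suc s)
      (\<lambda>(i, j). if i = 0 then monomial (k j) else const_poly (?g i j)))"
    unfolding det_poly_def Suc_eq_plus1
    by (intro arg_cong[where f = Determinant.det] cong_mat) auto
  then have "E (monomial (h l) * det_poly E s r k h b) = Determinant.det ?A"
    by (simp only: functional_mult_det[OF assms(1)])
  also have "\<dots> = 0"
  proof (rule det_identical_rows)
    show "Matrix.row ?A 0 = Matrix.row ?A (Suc l)"
      using assms(2,3) by (intro eq_vecI) (simp_all add: monomial_mult moment_def add.commute)
  qed (use assms(2,3) in auto)
  finally show ?thesis .
qed

lemma finite_box: "finite {0..n :: nat ^ 'i::finite}"
proof (rule finite_subset)
  show "{0..n} \<subseteq> vec_lambda ` (UNIV \<rightarrow>\<^sub>E {0..Max (range (($) n))})"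
  proof
    fix x assume "x \<in> {0..n}"
    then have "x $ i \<le> Max (range (($) n))" for i
      by (meson Max_ge atLeastAtMost_iff finite finite_imageI Finite_Cartesian_Product.less_eq_vec_def order_trans rangeI)
    then show "x \<in> vec_lambda ` (UNIV \<rightarrow>\<^sub>E {0..Max (range (($) n))})"
      by (intro image_eqI[of _ _ "($) x"]) auto
  qed
qed (auto intro!: finite_PiE)

lemma box_size_diff_less:
  fixes n m :: "nat ^ 'i::finite"
  assumes "0 < m" and "m \<le> n"
  shows "box_size (n - m) < box_size n"
  unfolding box_size_def
proof (rule psubset_card_mono[OF finite_box])
  have le: "n - m \<le> n"
    by (simp add: Finite_Cartesian_Product.less_eq_vec_def)
  obtain i where i: "m $ i \<noteq> 0"
    using assms(1)
    by (auto simp: Finite_Cartesian_Product.less_vec_def Finite_Cartesian_Product.less_eq_vec_def)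
  moreover have "m $ i \<le> n $ i"
    using assms(2) by (simp add: Finite_Cartesian_Product.less_eq_vec_def)
  ultimately have "(n - m) $ i < n $ i"
    by simp
  then have "\<not> n \<le> n - m"
    by (auto simp: Finite_Cartesian_Product.less_eq_vec_def not_le)
  moreover have "0 \<le> n"
    by (simp add: Finite_Cartesian_Product.less_eq_vec_def)
  ultimately show "{0..n - m} \<subset> {0..n}"
    using le by (auto intro: order_trans)
qed

lemma box_size_pos: "0 < box_size n"
  unfolding box_size_def by (subst card_gt_0_iff) (auto simp: finite_box Finite_Cartesian_Product.less_eq_vec_def)

theorem theorem10:
  fixes E :: "('i::finite, 'a::field_char_0) mpoly \<Rightarrow> 'a"
    and k h :: "nat ^ 'i \<Rightarrow> nat ^ 'i \<Rightarrow> nat \<Rightarrow> nat ^ 'i"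
    and b :: "nat ^ 'i \<Rightarrow> nat ^ 'i \<Rightarrow> nat \<Rightarrow> nat \<Rightarrow> 'a"
    and p :: "nat ^ 'i \<Rightarrow> nat ^ 'i \<Rightarrow> ('i, 'a) mpoly"
  assumes "linear_functional E"
    and "\<And>n m. 0 < m \<Longrightarrow> m \<le> n \<Longrightarrow> enumerates_box (k n m) n"
    and "\<And>n m. 0 < m \<Longrightarrow> m \<le> n \<Longrightarrow> enumerates_box (h n m) (n - m)"
    and "\<And>n m. 0 < m \<Longrightarrow> m \<le> n \<Longrightarrow>
      p n m = det_poly E (box_size n - 1) (box_size (n - m) - 1) (k n m) (h n m) (b n m)"
    and "\<And>n m. 0 < m \<Longrightarrow> m \<le> n \<Longrightarrow> of_degree (p n m) n"
  shows "generalized_orthogonal_system E p"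
  unfolding generalized_orthogonal_system_def
proof (intro allI impI conjI; elim conjE)
  fix n m :: "nat ^ 'i" assume nm: "0 < m" "m \<le> n"
  then show "of_degree (p n m) n"
    by (rule assms(5))
  fix q :: "nat ^ 'i" assume q: "0 \<le> q" "q \<le> n - m"
  have "q \<in> h n m ` {0..box_size (n - m) - 1}"
    using assms(3)[OF nm] q by (simp add: enumerates_box_def bij_betw_def)
  then obtain l where l: "l \<le> box_size (n - m) - 1" "q = h n m l"
    by auto
  have "box_size (n - m) - 1 < box_size n - 1"
    using box_size_diff_less[OF nm] box_size_pos[of "n - m"] by linarith
  then show "E (monomial q * p n m) = 0"
    using assms(4)[OF nm] functional_monomial_mult_det_poly[OF assms(1) l(1)] l(2) by simp
qed

end
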